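(* Let $\lambda,c>0$ be given and let $L:\mathbb R^M\to\mathbb R$ be a function (depending on data $\mathcal X,\mathcal Y$). If $L$ is differentiable in $\beta$, then a solution $$\bar\beta=\arg\min_\beta\ L(\beta)+\lambda\sum_{j=1}^M|\beta_j|+c\sum_{j=1}^M\beta_j^2$$ satisfies $$\left|\frac{\partial L(\bar\beta)}{\partial\beta_j}+2c\bar\beta_j\right|=\lambda\quad\text{if }\bar\beta_j\ne0,$$ $$\left|\frac{\partial L(\bar\beta)}{\partial\beta_j}+2c\bar\beta_j\right|=\left|\frac{\partial L(\bar\beta)}{\partial\beta_j}\right|\le\lambda\quad\text{if }\bar\beta_j=0.$$ Moreover, the solution of this minimization problem is unique for both the square loss $L(\beta)=\frac1n\sum_{i=1}^n\{Y_i-\beta'\mathbf X_i\}^2$ and the logistic loss $L(\beta)=\frac1n\sum_{i=1}^n\{-Y_i\beta'\mathbf X_i+\log(1+\exp\beta'\mathbf X_i)\}$, respectively.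
   Context: The data are $(\mathbf X_i,Y_i)$, $1\le i\le n$, with $\mathbf X_i=(X_{i1},\dots,X_{iM})'\in\mathbb R^M$ and $Y_i\in\mathbb R$ (for the square loss) or $Y_i\in\{0,1\}$ (for the logistic loss); $\mathcal Y=(Y_1,\dots,Y_n)$ and $\mathcal X$ is the $n\times M$ matrix with entries $X_{ij}$. *)

theory Defs
  imports "HOL-Analysis.Analysis"
begin

definition partial_deriv :: "(real^'m \<Rightarrow> real) \<Rightarrow> 'm \<Rightarrow> real^'m \<Rightarrow> real" where
  "partial_deriv L j b = deriv (\<lambda>t. L (\<chi> k. if k = j then t else b $ k)) (b $ j)"

definition penalized :: "(real^'m \<Rightarrow> real) \<Rightarrow> real \<Rightarrow> real \<Rightarrow> real^'m \<Rightarrow> real" where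
  "penalized L lam c b =
     L b + lam * (\<Sum>j\<in>UNIV. \<bar>b $ j\<bar>) + c * (\<Sum>j\<in>UNIV. (b $ j)\<^sup>2)"

abbreviation is_solution :: "(real^'m \<Rightarrow> real) \<Rightarrow> real \<Rightarrow> real \<Rightarrow> real^'m \<Rightarrow> bool" where
  "is_solution L lam c b \<equiv> is_arg_min (penalized L lam c) (\<lambda>_. True) b"

text \<open>The data are an n by M design matrix \<open>X\<close>, whose row \<open>X $ i\<close> is the i-th
  covariate vector, and a response vector \<open>Y\<close>; here n is \<open>CARD('n)\<close> and M is \<open>CARD('m)\<close>.\<close>

definition square_loss :: "real^'m^'n \<Rightarrow> real^'n \<Rightarrow> real^'m \<Rightarrow> real" where
  "square_loss X Y b = (1 / real CARD('n)) * (\<Sum>i\<in>UNIV. (Y $ i - b \<bullet> X $ i)\<^sup>2)"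

definition logistic_loss :: "real^'m^'n \<Rightarrow> real^'n \<Rightarrow> real^'m \<Rightarrow> real" where
  "logistic_loss X Y b =
     (1 / real CARD('n)) * (\<Sum>i\<in>UNIV. - (Y $ i) * (b \<bullet> X $ i) + ln (1 + exp (b \<bullet> X $ i)))"

end

theory Submission
  imports Defs
begin

text \<open>The optimality conditions come from restricting the objective to the coordinate lines through
  the minimizer, where it is a differentiable function plus \<open>lam * \<bar>t\<bar>\<close>. For existence, a nonnegative
  loss makes the objective at least \<open>c * (norm b)\<^sup>2\<close>, so it suffices to minimize over a ball;
  for uniqueness, the ridge term makes a convex loss strictly convex at midpoints.\<close>

text \<open>Fermat's rule for a differentiable function plus a kink at 0. The bound follows from the
  one-sided slopes at a minimizer, wherever it lies; the signed equality holds because the absolute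
  value is linear near any \<open>a \<noteq> 0\<close>.\<close>

lemma abs_penalized_minimum:
  fixes f :: "real \<Rightarrow> real"
  assumes D: "(f has_real_derivative D) (at a)" and "0 \<le> lam"
    and min: "\<And>t. f a + lam * \<bar>a\<bar> \<le> f t + lam * \<bar>t\<bar>"
  shows "\<bar>D\<bar> \<le> lam" and "a \<noteq> 0 \<Longrightarrow> D = - lam * sgn a"
proof -
  \<comment> \<open>The triangle inequality moves the kink from 0 to \<open>a\<close>: the point
    \<open>a\<close> also minimizes \<open>f t + lam * \<bar>t - a\<bar>\<close>, whose right and
    left slopes there are \<open>D + lam\<close> and \<open>D - lam\<close>. A wrong sign of either
    slope would give a smaller value at distance \<open>d / 2\<close>.\<close>
  have lip: "f a \<le> f t + lam * \<bar>t - a\<bar>" for t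
  proof -
    have "lam * \<bar>t\<bar> \<le> lam * (\<bar>a\<bar> + \<bar>t - a\<bar>)"
      using \<open>0 \<le> lam\<close> by (intro mult_left_mono) auto
    then show ?thesis using min[of t] by (simp add: distrib_left)
  qed
  have "0 \<le> D + lam"
  proof (rule ccontr)
    assume "\<not> 0 \<le> D + lam"
    moreover have "((\<lambda>t. f t + lam * t) has_real_derivative D + lam) (at a)"
      by (auto intro!: derivative_eq_intros D)
    ultimately obtain d where "d > 0"
      and d: "\<And>h. h > 0 \<Longrightarrow> h < d \<Longrightarrow> f (a + h) + lam * (a + h) < f a + lam * a"
      using DERIV_neg_dec_right[of "\<lambda>t. f t + lam * t" "D + lam" a] by force
    then show False
      using lip[of "a + d / 2"] d[of "d / 2"] by (simp add: distrib_left)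
  qed
  moreover have "D - lam \<le> 0"
  proof (rule ccontr)
    assume "\<not> D - lam \<le> 0"
    moreover have "((\<lambda>t. f t - lam * t) has_real_derivative D - lam) (at a)"
      by (auto intro!: derivative_eq_intros D)
    ultimately obtain d where "d > 0"
      and d: "\<And>h. h > 0 \<Longrightarrow> h < d \<Longrightarrow> f (a - h) - lam * (a - h) < f a - lam * a"
      using DERIV_pos_inc_left[of "\<lambda>t. f t - lam * t" "D - lam" a] by force
    then show False
      using lip[of "a - d / 2"] d[of "d / 2"] by (simp add: right_diff_distrib)
  qed
  ultimately show "\<bar>D\<bar> \<le> lam" by linarith
  show "D = - lam * sgn a" if "a \<noteq> 0"
  proof -
    have "((\<lambda>t. f t + lam * (sgn a * t)) has_real_derivative D + lam * sgn a) (at a)"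
      by (auto intro!: derivative_eq_intros D)
    \<comment> \<open>The radius \<open>\<bar>a\<bar>\<close> keeps \<open>t\<close> on the same
      side of 0 as \<open>a\<close>, so the penalty equals the linear function
      \<open>lam * (sgn a * t)\<close> there and the ordinary derivative test applies.\<close>
    moreover have "f a + lam * (sgn a * a) \<le> f t + lam * (sgn a * t)" if "\<bar>a - t\<bar> < \<bar>a\<bar>" for t
    proof -
      have "sgn a * a = \<bar>a\<bar>" "sgn a * t = \<bar>t\<bar>"
        using that by (auto simp: sgn_if abs_if split: if_splits)
      then show ?thesis using min[of t] by simp
    qed
    ultimately have "D + lam * sgn a = 0"
      using DERIV_local_min[of "\<lambda>t. f t + lam * (sgn a * t)" _ a "\<bar>a\<bar>"] that by force
    then show ?thesis by simp
  qed
qed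

text \<open>\<open>deriv\<close> is a choice operator, so \<open>partial_deriv\<close> is meaningful
  only once a derivative is known to exist. Differentiability of \<open>L\<close> composed with the
  affine coordinate line through \<open>b\<close> provides it.\<close>

lemma has_partial_deriv:
  fixes L :: "real^'m \<Rightarrow> real"
  assumes "L differentiable (at b)"
  shows "((\<lambda>t. L (\<chi> k. if k = j then t else b $ k)) has_real_derivative partial_deriv L j b)
    (at (b $ j))"
proof -
  let ?line = "\<lambda>t. \<chi> k. if k = j then t else b $ k"
  have line: "?line = (\<lambda>t. b + (t - b $ j) *\<^sub>R axis j 1)"
    by (auto simp: fun_eq_iff vec_eq_iff axis_def)
  have "?line differentiable (at (b $ j))"
    unfolding line by simp
  moreover have "?line (b $ j) = b"
    by (simp add: vec_eq_iff)
  ultimately have "(\<lambda>t. L (?line t)) differentiable (at (b $ j))"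
    using assms by (metis differentiable_compose)
  then show ?thesis
    unfolding partial_deriv_def
    using DERIV_deriv_iff_real_differentiable by blast
qed

text \<open>Only the \<open>j\<close>-th summands vary along the line; the last bracket is free of
  \<open>t\<close> and cancels when two points of the line are compared.\<close>

lemma penalized_coordinate_line:
  fixes b :: "real^'m"
  shows "penalized L lam c (\<chi> k. if k = j then t else b $ k) =
    L (\<chi> k. if k = j then t else b $ k) + c * t\<^sup>2 + lam * \<bar>t\<bar>
      + (lam * (\<Sum>k\<in>UNIV - {j}. \<bar>b $ k\<bar>) + c * (\<Sum>k\<in>UNIV - {j}. (b $ k)\<^sup>2))"
  by (simp add: penalized_def sum.remove[of UNIV j] distrib_left)

lemma is_solution_partial_deriv:
  fixes L :: "real^'m \<Rightarrow> real"
  assumes "L differentiable (at b)" and sol: "is_solution L lam c b" and "0 \<le> lam"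
  shows "\<bar>partial_deriv L j b + 2 * c * b $ j\<bar> \<le> lam"
    and "b $ j \<noteq> 0 \<Longrightarrow> partial_deriv L j b + 2 * c * b $ j = - lam * sgn (b $ j)"
proof -
  let ?line = "\<lambda>t. \<chi> k. if k = j then t else b $ k"
  \<comment> \<open>The ridge term is counted with the smooth part, which produces the summand
    \<open>2 * c * b $ j\<close> and leaves only \<open>lam * \<bar>t\<bar>\<close> as
    penalty.\<close>
  let ?f = "\<lambda>t. L (?line t) + c * t\<^sup>2"
  have D: "(?f has_real_derivative partial_deriv L j b + 2 * c * b $ j) (at (b $ j))"
    by (auto intro!: derivative_eq_intros has_partial_deriv assms(1))
  have "?line (b $ j) = b"
    by (simp add: vec_eq_iff)
  then have "penalized L lam c (?line (b $ j)) \<le> penalized L lam c (?line t)" for t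
    using sol by (simp add: is_arg_min_linorder)
  then have min: "?f (b $ j) + lam * \<bar>b $ j\<bar> \<le> ?f t + lam * \<bar>t\<bar>" for t
    unfolding penalized_coordinate_line by simp
  show "\<bar>partial_deriv L j b + 2 * c * b $ j\<bar> \<le> lam"
    using abs_penalized_minimum(1)[OF D \<open>0 \<le> lam\<close> min] .
  show "partial_deriv L j b + 2 * c * b $ j = - lam * sgn (b $ j)" if "b $ j \<noteq> 0"
    using abs_penalized_minimum(2)[OF D \<open>0 \<le> lam\<close> min that] .
qed

lemma penalized_eq_norm:
  "penalized L lam c b = L b + lam * (\<Sum>j\<in>UNIV. \<bar>b $ j\<bar>) + c * (norm b)\<^sup>2"
  unfolding penalized_def power2_norm_eq_inner inner_vec_def by (simp add: power2_eq_square)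

lemma convex_on_sum_fun:
  assumes "finite I" "convex S" "\<And>i. i \<in> I \<Longrightarrow> convex_on S (f i)"
  shows "convex_on S (\<lambda>x. \<Sum>i\<in>I. f i x)"
  using assms by (induction I) (auto simp: convex_on_const)

lemma convex_on_compose_inner:
  fixes x :: "'a::real_inner"
  assumes "convex_on UNIV f"
  shows "convex_on UNIV (\<lambda>b. f (b \<bullet> x))"
  using assms by (auto simp: convex_on_def inner_add_left)

lemma convex_on_abs_component: "convex_on UNIV (\<lambda>b :: real^'m. \<bar>b $ j\<bar>)"
proof (rule convex_onI)
  fix t :: real and x y :: "real^'m"
  assume "0 < t" "t < 1"
  then show "\<bar>((1 - t) *\<^sub>R x + t *\<^sub>R y) $ j\<bar> \<le> (1 - t) * \<bar>x $ j\<bar> + t * \<bar>y $ j\<bar>"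
    using abs_triangle_ineq[of "(1 - t) * x $ j" "t * y $ j"] by (simp add: abs_mult)
qed simp

lemma ex1_solution:
  fixes L :: "real^'m \<Rightarrow> real"
  assumes L: "convex_on UNIV L" and nonneg: "\<And>b. 0 \<le> L b" and "0 \<le> lam" "0 < c"
  shows "\<exists>!b. is_solution L lam c b"
proof -
  define G where "G = (\<lambda>b :: real^'m. L b + lam * (\<Sum>j\<in>UNIV. \<bar>b $ j\<bar>))"
  have G: "convex_on UNIV G"
    unfolding G_def using L \<open>0 \<le> lam\<close>
    by (intro convex_on_add convex_on_cmul convex_on_sum_fun convex_on_abs_component) auto
  have G_nonneg: "0 \<le> G b" for b
    unfolding G_def using nonneg[of b] \<open>0 \<le> lam\<close> by (simp add: sum_nonneg)
  define F where "F = (\<lambda>b. G b + c * (norm b)\<^sup>2)"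
  have pen: "penalized L lam c = F"
    by (simp add: fun_eq_iff penalized_eq_norm F_def G_def)
  have "continuous_on UNIV F"
    \<comment> \<open>Continuity comes from convexity alone: a real-valued convex function on the
      whole finite-dimensional space is continuous.\<close>
    unfolding F_def using convex_on_continuous[OF open_UNIV G]
    by (intro continuous_intros)
  \<comment> \<open>The radius solves \<open>c * R\<^sup>2 = F 0\<close>, so outside the ball the
    ridge term alone is already at least the value at the origin.\<close>
  define R where "R = sqrt (G 0 / c)"
  have "R \<ge> 0" using G_nonneg[of 0] \<open>0 < c\<close> by (simp add: R_def)
  have "continuous_on (cball 0 R) F"
    using \<open>continuous_on UNIV F\<close> continuous_on_subset by blast
  moreover have "cball (0 :: real^'m) R \<noteq> {}" using \<open>R \<ge> 0\<close> by simp
  ultimately obtain b where "b \<in> cball 0 R" and b: "\<And>x. x \<in> cball 0 R \<Longrightarrow> F b \<le> F x"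
    using continuous_attains_inf[OF compact_cball] by blast
  have "F b \<le> F x" for x
  proof (cases "x \<in> cball 0 R")
    case False
    have "F b \<le> F 0" using b[of 0] \<open>R \<ge> 0\<close> by simp
    also have "F 0 = c * R\<^sup>2"
      using G_nonneg[of 0] \<open>0 < c\<close> by (simp add: F_def R_def)
    also have "\<dots> \<le> c * (norm x)\<^sup>2"
      using False \<open>R \<ge> 0\<close> \<open>0 < c\<close> by (intro mult_left_mono power_mono) auto
    also have "\<dots> \<le> F x" using G_nonneg[of x] by (simp add: F_def)
    finally show ?thesis .
  qed (rule b)
  moreover have "x = y" if x: "\<And>z. F x \<le> F z" and y: "\<And>z. F y \<le> F z" for x y
  proof -
    define m where "m = (1 / 2) *\<^sub>R x + (1 / 2) *\<^sub>R y"
    have "G m \<le> (1 / 2) * G x + (1 / 2) * G y"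
      using convex_onD[OF G, of "1 / 2" x y] by (simp add: m_def)
    \<comment> \<open>This is the parallelogram law. It puts the value at the midpoint below the
      average of \<open>F x\<close> and \<open>F y\<close> by at least a quarter of
      \<open>c * (norm (x - y))\<^sup>2\<close>; as neither value exceeds \<open>F m\<close>, this
      gap must vanish.\<close>
    moreover have norm_m: "(norm m)\<^sup>2 = (1 / 2) * (norm x)\<^sup>2 + (1 / 2) * (norm y)\<^sup>2 - (1 / 4) * (norm (x - y))\<^sup>2"
      unfolding power2_norm_eq_inner m_def
      by (simp add: inner_simps inner_commute algebra_simps)
    have "c * (norm m)\<^sup>2 =
        (1 / 2) * (c * (norm x)\<^sup>2) + (1 / 2) * (c * (norm y)\<^sup>2) - (1 / 4) * (c * (norm (x - y))\<^sup>2)"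
      unfolding norm_m by (simp add: algebra_simps)
    ultimately have "F m \<le> (1 / 2) * F x + (1 / 2) * F y - (1 / 4) * (c * (norm (x - y))\<^sup>2)"
      unfolding F_def distrib_left by linarith
    then have "c * (norm (x - y))\<^sup>2 \<le> 0" using x[of m] y[of m] by linarith
    then show "x = y" using \<open>0 < c\<close> by (simp add: mult_le_0_iff)
  qed
  ultimately show ?thesis
    unfolding pen is_arg_min_linorder by blast
qed

text \<open>Both losses average scalar functions of the linear predictors
  \<open>b \<bullet> X $ i\<close>, so convexity and nonnegativity need checking only for functions
  of one real variable.\<close>

lemma ex1_solution_mean_loss:
  fixes X :: "real^'m^'n" and f :: "'n \<Rightarrow> real \<Rightarrow> real"
  assumes "\<And>i. convex_on UNIV (f i)" and "\<And>i s. 0 \<le> f i s" and "0 \<le> lam" "0 < c"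
  shows "\<exists>!b. is_solution (\<lambda>b. (1 / real CARD('n)) * (\<Sum>i\<in>UNIV. f i (b \<bullet> X $ i))) lam c b"
  using assms
  by (intro ex1_solution convex_on_cmul convex_on_sum_fun convex_on_compose_inner)
     (auto intro!: divide_nonneg_nonneg sum_nonneg)

lemma convex_on_square_residual: "convex_on UNIV (\<lambda>s :: real. (y - s)\<^sup>2)"
  by (rule f''_ge0_imp_convex[where f' = "\<lambda>s. - 2 * (y - s)" and f'' = "\<lambda>s. 2"])
     (auto intro!: derivative_eq_intros)

lemma convex_on_logistic: "convex_on UNIV (\<lambda>s :: real. - y * s + ln (1 + exp s))"
proof (rule f''_ge0_imp_convex)
  fix s :: real
  have pos: "1 + exp s > 0" by (simp add: add_pos_pos)
  show "((\<lambda>s. - y * s + ln (1 + exp s)) has_real_derivative - y + exp s / (1 + exp s)) (at s)"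
    using pos by (auto intro!: derivative_eq_intros)
  show "((\<lambda>s. - y + exp s / (1 + exp s)) has_real_derivative exp s / (1 + exp s)\<^sup>2) (at s)"
    using pos by (auto intro!: derivative_eq_intros simp: power2_eq_square field_simps)
qed auto

lemma logistic_nonneg:
  assumes "y \<in> {0, 1}"
  shows "0 \<le> - y * s + ln (1 + exp s :: real)"
proof -
  \<comment> \<open>The first bound settles \<open>y = 1\<close>, since
    \<open>ln (exp s) = s\<close>; the second settles \<open>y = 0\<close>.\<close>
  have "ln (exp s) \<le> ln (1 + exp s)" "0 \<le> ln (1 + exp s)"
    by (subst ln_le_cancel_iff) (simp_all add: add_pos_pos)
  then show ?thesis using assms by auto
qed

theorem lemma4p3:
  fixes lam c :: real and X :: "real^'m^'n" and Y :: "real^'n"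
  assumes "lam > 0" and "c > 0"
  shows "(\<forall>(L :: real^'m \<Rightarrow> real) b.
            (\<forall>x. L differentiable (at x)) \<longrightarrow> is_solution L lam c b \<longrightarrow>
            (\<forall>j. (b $ j \<noteq> 0 \<longrightarrow> \<bar>partial_deriv L j b + 2 * c * b $ j\<bar> = lam) \<and>
                 (b $ j = 0 \<longrightarrow>
                    \<bar>partial_deriv L j b + 2 * c * b $ j\<bar> = \<bar>partial_deriv L j b\<bar> \<and>
                    \<bar>partial_deriv L j b\<bar> \<le> lam)))
       \<and> (\<exists>!b. is_solution (square_loss X Y) lam c b)
       \<and> ((\<forall>i. Y $ i \<in> {0, 1}) \<longrightarrow> (\<exists>!b. is_solution (logistic_loss X Y) lam c b))"
proof (intro conjI allI impI)
  fix L :: "real^'m \<Rightarrow> real" and b j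
  assume "\<forall>x. L differentiable (at x)" and sol: "is_solution L lam c b"
  then have "L differentiable (at b)" by blast
  note opt = is_solution_partial_deriv[OF this sol less_imp_le[OF \<open>lam > 0\<close>], of j]
  show "\<bar>partial_deriv L j b + 2 * c * b $ j\<bar> = lam" if "b $ j \<noteq> 0"
    using opt(2)[OF that] that \<open>lam > 0\<close> by (simp add: abs_mult abs_sgn_eq)
  show "\<bar>partial_deriv L j b + 2 * c * b $ j\<bar> = \<bar>partial_deriv L j b\<bar>" if "b $ j = 0"
    using that by simp
  show "\<bar>partial_deriv L j b\<bar> \<le> lam" if "b $ j = 0"
    using opt(1) that by simp
next
  show "\<exists>!b. is_solution (square_loss X Y) lam c b"
    unfolding square_loss_def [abs_def] using assms
    by (intro ex1_solution_mean_loss convex_on_square_residual) auto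
next
  assume "\<forall>i. Y $ i \<in> {0, 1}"
  then show "\<exists>!b. is_solution (logistic_loss X Y) lam c b"
    unfolding logistic_loss_def [abs_def] using assms
    by (intro ex1_solution_mean_loss[where f = "\<lambda>i s. - (Y $ i) * s + ln (1 + exp s)"]
        convex_on_logistic logistic_nonneg) auto
qed

end
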